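(* Let $G$ be a graph with $n\ge 1$ vertices and $m$ edges and without isolated vertices, and let $I(G)$ denote either of the entropies $I^1_{\mathscr{L}}(G)$, $I^1_{\mathcal{Q}}(G)$. (i) If $n$ is odd, then $$1-\frac{2}{n}+\frac{1}{n^2}\le I(G)\le 1-\frac{1}{n-1},$$ and if $n$ is even, then $$1-\frac{2}{n}\le I(G)\le 1-\frac{1}{n-1}.$$ Equality holds on the right if and only if $G$ is a complete graph. Equality holds on the left if and only if $G$ is the disjoint union of $\frac n2$ paths of length $1$ when $n$ is even, and if and only if $G$ is the disjoint union of $\frac{n-3}{2}$ paths of length $1$ and a path of length $2$ when $n$ is odd. (ii) If $\delta$ and $\Delta$ are the minimum and maximum degree of $G$, then $$1-\frac1n-\frac{1}{n\delta}\le I(G)\le 1-\frac1n-\frac{1}{n\Delta}.$$ Equality occurs in both bounds if and only if $G$ is a regular graph.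
   Context: Graphs are finite and simple. Let $D(G)$ be the diagonal matrix of vertex degrees, $A(G)$ the adjacency matrix, $\mathscr{L}(G)=D(G)^{-1/2}(D(G)-A(G))D(G)^{-1/2}$ the normalized Laplacian and $\mathcal{Q}(G)=D(G)^{-1/2}(D(G)+A(G))D(G)^{-1/2}$ the normalized signless Laplacian. For an $n\times n$ matrix $M$ associated with $G$ with eigenvalues $\lambda_1,\dots,\lambda_n$, put $p_i=|\lambda_i|/\sum_{j=1}^n|\lambda_j|$ and $I^1_M(G)=\sum_{i=1}^n p_i(1-p_i)$; $I^1_{\mathscr L}(G)$ and $I^1_{\mathcal Q}(G)$ are these entropies for $M=\mathscr{L}(G)$ and $M=\mathcal{Q}(G)$. The length of a path is its number of edges. *)

theory Defs
  imports
    "HOL-Analysis.Analysis"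
    "Graph_Theory.Graph_Theory"
    "Jordan_Normal_Form.Char_Poly"
begin

section \<open>Graphs\<close>

text \<open>
  Finite simple graphs are the symmetric loop-free pair digraphs \<^locale>\<open>pair_graph\<close>:
  an undirected edge uv is the pair of arcs (u,v), (v,u), and the degree of a vertex
  is its out-degree.
\<close>

abbreviation vdegree :: "'a pair_pre_digraph \<Rightarrow> 'a \<Rightarrow> nat" where
  "vdegree G v \<equiv> out_degree (with_proj G) v"

definition edges :: "'a pair_pre_digraph \<Rightarrow> 'a set set" where
  "edges G = (\<lambda>(u, v). {u, v}) ` parcs G"

definition isolated :: "'a pair_pre_digraph \<Rightarrow> 'a \<Rightarrow> bool" where
  "isolated G v \<longleftrightarrow> v \<in> pverts G \<and> vdegree G v = 0"

definition min_degree :: "'a pair_pre_digraph \<Rightarrow> nat" where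
  "min_degree G = Min (vdegree G ` pverts G)"

definition max_degree :: "'a pair_pre_digraph \<Rightarrow> nat" where
  "max_degree G = Max (vdegree G ` pverts G)"

definition regular_graph :: "'a pair_pre_digraph \<Rightarrow> bool" where
  "regular_graph G \<longleftrightarrow> (\<exists>r. \<forall>v \<in> pverts G. vdegree G v = r)"

text \<open>The length of a path is its number of edges, so it has one vertex more.\<close>

definition path_graph :: "nat \<Rightarrow> 'a pair_pre_digraph \<Rightarrow> bool" where
  "path_graph l P \<longleftrightarrow> (\<exists>xs. distinct xs \<and> length xs = Suc l \<and> pverts P = set xs \<and>
     parcs P = {(xs ! i, xs ! Suc i) | i. i < l} \<union> {(xs ! Suc i, xs ! i) | i. i < l})"

definition is_disjoint_union :: "'a pair_pre_digraph \<Rightarrow> 'a pair_pre_digraph list \<Rightarrow> bool" where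
  "is_disjoint_union G Hs \<longleftrightarrow>
     (\<forall>i < length Hs. \<forall>j < length Hs. i \<noteq> j \<longrightarrow> pverts (Hs ! i) \<inter> pverts (Hs ! j) = {}) \<and>
     pverts G = (\<Union>H \<in> set Hs. pverts H) \<and>
     parcs G = (\<Union>H \<in> set Hs. parcs H)"

section \<open>Matrices of a graph\<close>

text \<open>
  Rows and columns are indexed by the positions of a list \<open>vs\<close> that enumerates the
  vertices without repetition. Another enumeration gives a permutation-similar matrix.
\<close>

definition degree_matrix :: "'a pair_pre_digraph \<Rightarrow> 'a list \<Rightarrow> real mat" where
  "degree_matrix G vs = mat_diag (length vs) (\<lambda>i. real (vdegree G (vs ! i)))"

definition adjacency_matrix :: "'a pair_pre_digraph \<Rightarrow> 'a list \<Rightarrow> real mat" where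
  "adjacency_matrix G vs = Matrix.mat (length vs) (length vs)
     (\<lambda>(i, j). if (vs ! i, vs ! j) \<in> parcs G then 1 else 0)"

definition inv_sqrt_degree_matrix :: "'a pair_pre_digraph \<Rightarrow> 'a list \<Rightarrow> real mat" where
  "inv_sqrt_degree_matrix G vs =
     mat_diag (length vs) (\<lambda>i. 1 / sqrt (real (vdegree G (vs ! i))))"

definition normalized_laplacian :: "'a pair_pre_digraph \<Rightarrow> 'a list \<Rightarrow> real mat" where
  "normalized_laplacian G vs =
     inv_sqrt_degree_matrix G vs * (degree_matrix G vs - adjacency_matrix G vs)
       * inv_sqrt_degree_matrix G vs"

definition normalized_signless_laplacian :: "'a pair_pre_digraph \<Rightarrow> 'a list \<Rightarrow> real mat" where
  "normalized_signless_laplacian G vs =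
     inv_sqrt_degree_matrix G vs * (degree_matrix G vs + adjacency_matrix G vs)
       * inv_sqrt_degree_matrix G vs"

section \<open>Entropy\<close>

text \<open>
  The complex eigenvalues with algebraic multiplicity, so that an n by n matrix has exactly
  n of them.
\<close>

definition eigenvalues_mset :: "real mat \<Rightarrow> complex multiset" where
  "eigenvalues_mset M = proots (char_poly (map_mat complex_of_real M))"

definition entropy1 :: "real mat \<Rightarrow> real" where
  "entropy1 M =
     (let S = (\<Sum>\<mu> \<in># eigenvalues_mset M. cmod \<mu>)
      in \<Sum>\<mu> \<in># eigenvalues_mset M. (let p = cmod \<mu> / S in p * (1 - p)))"

end

theory Submission
  imports Defs "Jordan_Normal_Form.Schur_Decomposition"
begin

text \<open>
  Let $R$ be the sum of $1/(d(u) d(v))$ over all arcs $(u,v)$ of the graph. Both normalized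
  Laplacians are symmetric and positive semidefinite, have trace $n$, and their squares have trace
  $n + R$. Their eigenvalues are therefore nonnegative reals with sum $n$ and sum of squares
  $n + R$, so that both entropies are equal to $1 - 1/n - R/n^2$
  (\<open>eigenvalues_mset_moments\<close>, \<open>entropy1_psd\<close>, \<open>entropy1_normalized\<close>).
  Bounds on the entropy are thus bounds on $R$ in the opposite direction.

  Since $\<Sum> 1/d(u)$ over all arcs is $n$, for every $k > 0$ the difference $n/k - R$ is the sum of
  $(1/d(u)) (1/k - 1/d(v))$ over all arcs. If all degrees are at least $k$, no term is negative,
  and if all degrees are at most $k$, no term is positive; in both cases the sum vanishes only if
  all degrees are equal to $k$ (\<open>arc_inv_degree_sum_upper\<close>, \<open>arc_inv_degree_sum_lower\<close>).
  The values $k = \<delta>$ and $k = \<Delta>$ give part (ii), $k = n - 1$ gives the upper bound of part (i),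
  which is attained only by the complete graph, and $k = 1$ gives the lower bound of part (i) for
  even $n$, which is attained only by the 1-regular graphs.

  For odd $n$ the graph cannot be 1-regular, so some vertex $w$ has degree at least 2. The edges
  at $w$ alone contribute at least 1 to $n - R$, so $R \<le> n - 1$; equality forces $w$ to have degree
  2 and all other vertices to have degree 1
  (\<open>arc_inv_degree_sum_branching\<close>, \<open>arc_inv_degree_sum_one_branching\<close>).
  The lemmas \<open>one_regular_iff_matching\<close> and \<open>one_branching_iff_path_2\<close> translate these
  degree conditions into disjoint unions of paths.
\<close>

section \<open>Eigenvalues of symmetric positive semidefinite matrices\<close>

definition trace_mat :: "'a :: comm_ring_1 mat \<Rightarrow> 'a" where
  "trace_mat A = (\<Sum>i<dim_row A. A $$ (i, i))"

lemma trace_mat_mult: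
  assumes "A \<in> carrier_mat n k" "B \<in> carrier_mat k n"
  shows "trace_mat (A * B) = (\<Sum>i<n. \<Sum>j<k. A $$ (i, j) * B $$ (j, i))"
  using assms by (auto simp: trace_mat_def scalar_prod_def lessThan_atLeast0 intro!: sum.cong)

lemma trace_mat_mult_commute:
  assumes "A \<in> carrier_mat n k" "B \<in> carrier_mat k n"
  shows "trace_mat (A * B) = trace_mat (B * A)"
  unfolding trace_mat_mult[OF assms] trace_mat_mult[OF assms(2,1)]
  by (subst sum.swap) (simp add: mult.commute)

lemma trace_mat_similar:
  assumes "similar_mat_wit A B P Q" "A \<in> carrier_mat n n"
  shows "trace_mat A = trace_mat B"
proof -
  note w = similar_mat_witD2[OF assms(2,1)]
  have "trace_mat A = trace_mat (P * (B * Q))"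
    using w by (simp add: assoc_mult_mat[of _ n n _ n _ n])
  also have "\<dots> = trace_mat ((B * Q) * P)"
    using w by (intro trace_mat_mult_commute) auto
  also have "(B * Q) * P = B"
    using w by (simp add: assoc_mult_mat[of _ n n _ n _ n])
  finally show ?thesis .
qed

lemma trace_mat_sq_similar:
  assumes "similar_mat_wit A B P Q" "A \<in> carrier_mat n n"
  shows "trace_mat (A * A) = trace_mat (B * B)"
proof -
  have "similar_mat_wit (A ^\<^sub>m 2) (B ^\<^sub>m 2) P Q"
    by (rule similar_mat_wit_pow[OF assms(1)])
  moreover have "A ^\<^sub>m 2 = A * A" "B ^\<^sub>m 2 = B * B"
    using similar_mat_witD2[OF assms(2,1)] by (simp_all add: numeral_2_eq_2)
  ultimately show ?thesis
    using trace_mat_similar[of "A * A" "B * B" P Q n] assms(2) by auto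
qed

text \<open>
  For $i \<noteq> j$ one of the entries at $(i,j)$ and $(j,i)$ lies below the diagonal.
\<close>

lemma trace_mat_sq_upper_triangular:
  assumes "B \<in> carrier_mat n n" "upper_triangular B"
  shows "trace_mat (B * B) = (\<Sum>i<n. (B $$ (i, i))\<^sup>2)"
proof -
  have "(\<Sum>j<n. B $$ (i, j) * B $$ (j, i)) = (B $$ (i, i))\<^sup>2" if "i < n" for i
  proof -
    have "B $$ (i, j) * B $$ (j, i) = 0" if "j < n" "j \<noteq> i" for j
      using upper_triangularD[OF assms(2), of i j] upper_triangularD[OF assms(2), of j i]
        assms(1) \<open>i < n\<close> that by (cases "i < j") auto
    then have "(\<Sum>j<n. B $$ (i, j) * B $$ (j, i)) = (\<Sum>j\<in>{i}. B $$ (i, j) * B $$ (j, i))"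
      using \<open>i < n\<close> by (intro sum.mono_neutral_right) auto
    then show ?thesis by (simp add: power2_eq_square)
  qed
  then show ?thesis by (simp add: trace_mat_mult[OF assms(1) assms(1)])
qed

lemma proots_linear_factors: "proots (\<Prod>e\<leftarrow>es. [:- e, 1:]) = mset (es :: 'a :: idom list)"
proof (induction es)
  case (Cons e es)
  have "(\<Prod>e\<leftarrow>es. [:- e, 1:]) \<noteq> 0" by (auto simp: prod_list_zero_iff)
  then have "proots ([:- e, 1:] * (\<Prod>e\<leftarrow>es. [:- e, 1:])) = proots [:- e, 1:] + mset es"
    by (subst proots_mult) (simp_all add: Cons.IH)
  then show ?case by simp
qed simp

text \<open>
  The Schur decomposition over the complex numbers makes the matrix similar to an upper
  triangular one whose diagonal lists the roots of the characteristic polynomial. Traces are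
  similarity invariants, so both power sums can be read off from the triangular matrix.
\<close>

lemma eigenvalues_mset_moments:
  assumes M: "M \<in> carrier_mat n n"
  shows "(\<Sum>\<mu>\<in>#eigenvalues_mset M. \<mu>) = complex_of_real (trace_mat M)"
    and "(\<Sum>\<mu>\<in>#eigenvalues_mset M. \<mu>\<^sup>2) = complex_of_real (trace_mat (M * M))"
proof -
  let ?A = "map_mat complex_of_real M"
  have A: "?A \<in> carrier_mat n n" using M by simp
  obtain es where es: "char_poly ?A = (\<Prod>e\<leftarrow>es. [:- e, 1:])"
    using char_poly_factorized[OF A] by blast
  obtain B P Q where "schur_decomposition ?A es = (B, P, Q)" by (metis prod_cases3)
  from schur_decomposition[OF A es this]
  have wit: "similar_mat_wit ?A B P Q" and B: "upper_triangular B" and diag: "diag_mat B = es"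
    by auto
  have BC: "B \<in> carrier_mat n n" using similar_mat_witD2[OF A wit] by simp
  have ev: "eigenvalues_mset M = mset es"
    by (simp add: eigenvalues_mset_def es proots_linear_factors)
  have es_sum: "(\<Sum>\<mu>\<in>#mset es. f \<mu>) = (\<Sum>i<n. f (B $$ (i, i)))" for f :: "complex \<Rightarrow> complex"
    unfolding diag[symmetric] diag_mat_def using BC
    by (simp add: o_def sum_mset_sum_list interv_sum_list_conv_sum_set_nat lessThan_atLeast0
        del: mset_map flip: mset_map)
  have "(\<Sum>\<mu>\<in>#eigenvalues_mset M. \<mu>) = trace_mat B"
    unfolding ev es_sum using BC by (simp add: trace_mat_def)
  also have "\<dots> = trace_mat ?A"
    using trace_mat_similar[OF wit A] by simp
  also have "\<dots> = complex_of_real (trace_mat M)"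
    using M by (simp add: trace_mat_def)
  finally show "(\<Sum>\<mu>\<in>#eigenvalues_mset M. \<mu>) = complex_of_real (trace_mat M)" .
  have "(\<Sum>\<mu>\<in>#eigenvalues_mset M. \<mu>\<^sup>2) = trace_mat (B * B)"
    unfolding ev es_sum trace_mat_sq_upper_triangular[OF BC B] ..
  also have "\<dots> = trace_mat (?A * ?A)"
    using trace_mat_sq_similar[OF wit A] by simp
  also have "\<dots> = complex_of_real (trace_mat (M * M))"
    using M by (simp add: trace_mat_mult[OF A A] trace_mat_mult[OF M M])
  finally show "(\<Sum>\<mu>\<in>#eigenvalues_mset M. \<mu>\<^sup>2) = complex_of_real (trace_mat (M * M))" .
qed

text \<open>
  Positive semidefiniteness is expressed by coordinate functions, so that the quadratic form
  of a graph can be handled by plain sums over index pairs.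
\<close>

definition psd_mat :: "nat \<Rightarrow> real mat \<Rightarrow> bool" where
  "psd_mat n M \<longleftrightarrow> M \<in> carrier_mat n n \<and> (\<forall>i<n. \<forall>j<n. M $$ (i, j) = M $$ (j, i)) \<and>
     (\<forall>x. 0 \<le> (\<Sum>i<n. \<Sum>j<n. x i * M $$ (i, j) * x j))"

text \<open>
  An eigenvector $z = x + iy$ satisfies $z^* M z = \<mu> \<cdot> |z|^2$, and the left-hand side is the
  value of the real form at $x$ plus its value at $y$; hence $\<mu>$ is a nonnegative real.
\<close>

lemma eigenvalues_mset_psd:
  assumes psd: "psd_mat n M" and mu: "\<mu> \<in># eigenvalues_mset M"
  shows "\<mu> = complex_of_real (cmod \<mu>)"
proof -
  let ?A = "map_mat complex_of_real M"
  have M: "M \<in> carrier_mat n n" and sym: "\<And>i j. i < n \<Longrightarrow> j < n \<Longrightarrow> M $$ (i, j) = M $$ (j, i)"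
    and nn: "\<And>x. 0 \<le> (\<Sum>i<n. \<Sum>j<n. x i * M $$ (i, j) * x j)"
    using psd by (auto simp: psd_mat_def)
  have A: "?A \<in> carrier_mat n n" using M by simp
  have "char_poly ?A \<noteq> 0" using degree_monic_char_poly[OF A] by auto
  then have "eigenvalue ?A \<mu>"
    using mu by (simp add: eigenvalue_root_char_poly[OF A] eigenvalues_mset_def)
  then obtain v where v: "v \<in> carrier_vec n" "v \<noteq> 0\<^sub>v n" "?A *\<^sub>v v = \<mu> \<cdot>\<^sub>v v"
    using A by (auto simp: eigenvalue_def eigenvector_def)
  define z where "z i = vec_index v i" for i
  define x y where "x i = Re (z i)" and "y i = Im (z i)" for i
  have row: "(\<Sum>j<n. complex_of_real (M $$ (i, j)) * z j) = \<mu> * z i" if "i < n" for i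
  proof -
    have "vec_index (?A *\<^sub>v v) i = (\<Sum>j<n. complex_of_real (M $$ (i, j)) * z j)"
      using that M v(1) by (auto simp: scalar_prod_def z_def lessThan_atLeast0 intro!: sum.cong)
    then show ?thesis using v that by (simp add: z_def)
  qed
  define q where "q = (\<Sum>i<n. (x i)\<^sup>2 + (y i)\<^sup>2)"
  define h where "h = (\<Sum>i<n. \<Sum>j<n. x i * M $$ (i, j) * x j) + (\<Sum>i<n. \<Sum>j<n. y i * M $$ (i, j) * y j)"
  have "0 < q"
  proof -
    obtain i where "i < n" "z i \<noteq> 0"
      using v(1,2) unfolding z_def by (metis carrier_vecD dim_vec index_zero_vec(1) eq_vecI zero_carrier_vec)
    then have "0 < (x i)\<^sup>2 + (y i)\<^sup>2"
      by (simp add: x_def y_def complex_eq_iff sum_power2_gt_zero_iff)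
    also have "\<dots> \<le> q" unfolding q_def using \<open>i < n\<close> by (intro member_le_sum) auto
    finally show ?thesis .
  qed
  \<comment> \<open>The hermitian form at \<open>z = x + iy\<close>: its imaginary part cancels by symmetry.\<close>
  have "(\<Sum>i<n. \<Sum>j<n. cnj (z i) * complex_of_real (M $$ (i, j)) * z j) = complex_of_real h"
  proof (rule complex_eqI)
    show "Re (\<Sum>i<n. \<Sum>j<n. cnj (z i) * complex_of_real (M $$ (i, j)) * z j) = Re (complex_of_real h)"
      unfolding h_def sum.distrib[symmetric] Re_sum Re_complex_of_real
      by (intro sum.cong refl) (simp add: x_def y_def algebra_simps)
    have "(\<Sum>i<n. \<Sum>j<n. y i * M $$ (i, j) * x j) = (\<Sum>i<n. \<Sum>j<n. x i * M $$ (i, j) * y j)"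
      by (subst sum.swap) (auto intro!: sum.cong simp: sym mult_ac)
    then have "(\<Sum>i<n. \<Sum>j<n. x i * M $$ (i, j) * y j - y i * M $$ (i, j) * x j) = 0"
      by (simp add: sum_subtractf)
    moreover have "Im (\<Sum>i<n. \<Sum>j<n. cnj (z i) * complex_of_real (M $$ (i, j)) * z j)
        = (\<Sum>i<n. \<Sum>j<n. x i * M $$ (i, j) * y j - y i * M $$ (i, j) * x j)"
      unfolding Im_sum by (intro sum.cong refl) (simp add: x_def y_def algebra_simps)
    ultimately show "Im (\<Sum>i<n. \<Sum>j<n. cnj (z i) * complex_of_real (M $$ (i, j)) * z j) = Im (complex_of_real h)"
      by simp
  qed
  moreover have "(\<Sum>i<n. \<Sum>j<n. cnj (z i) * complex_of_real (M $$ (i, j)) * z j) = \<mu> * complex_of_real q"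
  proof -
    have "(\<Sum>i<n. \<Sum>j<n. cnj (z i) * complex_of_real (M $$ (i, j)) * z j)
        = (\<Sum>i<n. cnj (z i) * (\<mu> * z i))"
      by (auto intro!: sum.cong simp: mult.assoc simp flip: row sum_distrib_left)
    also have "\<dots> = (\<Sum>i<n. \<mu> * complex_of_real ((x i)\<^sup>2 + (y i)\<^sup>2))"
      by (intro sum.cong refl) (simp add: x_def y_def complex_eq_iff power2_eq_square algebra_simps)
    finally show ?thesis by (simp only: q_def of_real_sum sum_distrib_left)
  qed
  ultimately have "\<mu> = complex_of_real (h / q)"
    using \<open>0 < q\<close> by (simp add: field_simps)
  moreover have "0 \<le> h / q" using \<open>0 < q\<close> nn[of x] nn[of y] by (simp add: h_def)
  ultimately show ?thesis by (metis norm_of_real abs_of_nonneg)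
qed

text \<open>
  The eigenvalues $\<lambda>$ are nonnegative, so the normalizing sum $S$ of their moduli is the trace of
  $M$, and $\<Sum> p (1 - p) = 1 - (\<Sum> \<lambda>^2) / S^2$, where $\<Sum> \<lambda>^2$ is the trace of $M^2$.
\<close>

lemma entropy1_psd:
  assumes psd: "psd_mat n M" and tr: "trace_mat M \<noteq> 0"
  shows "entropy1 M = 1 - trace_mat (M * M) / (trace_mat M)\<^sup>2"
proof -
  let ?E = "eigenvalues_mset M" and ?t = "trace_mat M"
  have M: "M \<in> carrier_mat n n" using psd by (simp add: psd_mat_def)
  have re: "complex_of_real (cmod \<mu>) = \<mu>" if "\<mu> \<in># ?E" for \<mu>
    using eigenvalues_mset_psd[OF psd that] by simp
  have "(\<forall>\<mu>\<in>#F. complex_of_real (cmod \<mu>) = \<mu>) \<Longrightarrow>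
      complex_of_real (\<Sum>\<mu>\<in>#F. cmod \<mu> ^ k) = (\<Sum>\<mu>\<in>#F. \<mu> ^ k)" for F k
    by (induction F) simp_all
  then have pow: "complex_of_real (\<Sum>\<mu>\<in>#?E. cmod \<mu> ^ k) = (\<Sum>\<mu>\<in>#?E. \<mu> ^ k)" for k
    using re by blast
  have "complex_of_real (\<Sum>\<mu>\<in>#?E. cmod \<mu>) = (\<Sum>\<mu>\<in>#?E. \<mu>)"
    using pow[of 1] by simp
  then have S: "(\<Sum>\<mu>\<in>#?E. cmod \<mu>) = ?t"
    unfolding eigenvalues_mset_moments[OF M] by (simp only: of_real_eq_iff)
  have Q: "(\<Sum>\<mu>\<in>#?E. (cmod \<mu>)\<^sup>2) = trace_mat (M * M)"
    using pow[of 2] unfolding eigenvalues_mset_moments[OF M] by (simp only: of_real_eq_iff)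
  have lin: "(\<Sum>\<mu>\<in>#F. cmod \<mu> / ?t * (1 - cmod \<mu> / ?t))
      = (\<Sum>\<mu>\<in>#F. cmod \<mu>) / ?t - (\<Sum>\<mu>\<in>#F. (cmod \<mu>)\<^sup>2) / ?t\<^sup>2" for F
    by (induction F) (simp_all add: add_divide_distrib algebra_simps power2_eq_square)
  show ?thesis
    unfolding entropy1_def Let_def S lin Q using tr by simp
qed

section \<open>Degree sums\<close>

lemma vdegree_eq_card_nbrs: "vdegree G v = card (parcs G `` {v})"
proof -
  have "out_arcs (with_proj G) v = Pair v ` (parcs G `` {v})"
    by (auto simp: out_arcs_def)
  then show ?thesis by (simp add: out_degree_def card_image inj_on_def)
qed

text \<open>
  Every edge contributes two arcs, so this is twice the general Randic index with exponent -1.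
\<close>

definition arc_inv_degree_sum :: "'a pair_pre_digraph \<Rightarrow> real" where
  "arc_inv_degree_sum G = (\<Sum>(u, v)\<in>parcs G. 1 / (real (vdegree G u) * real (vdegree G v)))"

locale isolated_free_graph = pair_graph +
  assumes vdegree_pos: "v \<in> pverts G \<Longrightarrow> 0 < vdegree G v"
begin

lemma arc_verts: "(u, v) \<in> parcs G \<Longrightarrow> u \<in> pverts G \<and> v \<in> pverts G"
  using in_arcsD1 in_arcsD2 by blast

lemma finite_nbrs: "finite (parcs G `` {v})"
  by (rule finite_subset[OF _ pair_finite_verts]) (auto dest: arc_verts)

lemma obtain_nbr:
  assumes "v \<in> pverts G"
  obtains u where "(u, v) \<in> parcs G" "(v, u) \<in> parcs G"
proof -
  have "parcs G `` {v} \<noteq> {}"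
    using vdegree_pos[OF assms] by (auto simp: vdegree_eq_card_nbrs)
  then show ?thesis using that arcs_symmetric by blast
qed

lemma sum_arcs_conv: "(\<Sum>(u, v)\<in>parcs G. f u v) = (\<Sum>u\<in>pverts G. \<Sum>v\<in>parcs G `` {u}. f u v)"
proof -
  have "parcs G = Sigma (pverts G) (\<lambda>u. parcs G `` {u})"
    by (auto dest: arc_verts)
  then show ?thesis
    using finite_nbrs pair_finite_verts by (simp add: sum.Sigma)
qed

text \<open>
  Each vertex $u$ is the tail of exactly $d(u)$ arcs, hence contributes 1.
\<close>

lemma sum_arcs_inv_tail_degree: "(\<Sum>(u, v)\<in>parcs G. 1 / real (vdegree G u)) = card (pverts G)"
proof -
  have one: "(\<Sum>v\<in>parcs G `` {u}. 1 / real (vdegree G u)) = 1" if "u \<in> pverts G" for u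
  proof -
    have "(\<Sum>v\<in>parcs G `` {u}. 1 / real (vdegree G u)) = real (vdegree G u) * (1 / real (vdegree G u))"
      by (simp only: sum_constant vdegree_eq_card_nbrs)
    also have "\<dots> = 1" using vdegree_pos[OF that] by simp
    finally show ?thesis .
  qed
  have "(\<Sum>(u, v)\<in>parcs G. 1 / real (vdegree G u)) = (\<Sum>u\<in>pverts G. 1)"
    unfolding sum_arcs_conv by (rule sum.cong[OF refl one])
  then show ?thesis by simp
qed

text \<open>
  The share of one arc in the gap between $n/k$ and the arc sum. For $k > 0$ its sign is that
  of $d(v) - k$, so every comparison of the degrees with $k$ becomes a comparison of the arc sum
  with $n/k$.
\<close>

definition arc_deficit :: "real \<Rightarrow> 'a \<times> 'a \<Rightarrow> real" where
  "arc_deficit k = (\<lambda>(u, v). 1 / real (vdegree G u) * (1 / k - 1 / real (vdegree G v)))"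

text \<open>
  Multiplied out, the sum is $1/k$ times \<open>sum_arcs_inv_tail_degree\<close> minus the arc sum.
\<close>

lemma sum_arc_deficit:
  "sum (arc_deficit k) (parcs G) = real (card (pverts G)) / k - arc_inv_degree_sum G"
proof -
  have "sum (arc_deficit k) (parcs G)
     = (\<Sum>(u, v)\<in>parcs G. 1 / real (vdegree G u)) * (1 / k) - arc_inv_degree_sum G"
    unfolding arc_inv_degree_sum_def arc_deficit_def sum_distrib_right
    by (simp add: algebra_simps split_def flip: sum_subtractf)
  then show ?thesis by (simp add: sum_arcs_inv_tail_degree)
qed

text \<open>
  Every vertex is the head of some arc because none is isolated; thus vanishing on all
  arcs reaches all vertices.
\<close>

lemma degree_const_iff_arc_deficit:
  assumes "0 < k"
  shows "(\<forall>v\<in>pverts G. vdegree G v = k) \<longleftrightarrow> (\<forall>e\<in>parcs G. arc_deficit (real k) e = 0)"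
    (is "?L \<longleftrightarrow> ?R")
proof
  assume ?R
  show ?L
  proof
    fix v assume v: "v \<in> pverts G"
    from v obtain u where u: "(u, v) \<in> parcs G" by (rule obtain_nbr)
    then have "arc_deficit (real k) (u, v) = 0" using \<open>?R\<close> by blast
    moreover have "0 < vdegree G u" using u vdegree_pos arc_verts by blast
    ultimately show "vdegree G v = k" using assms v vdegree_pos[OF v] by (simp add: arc_deficit_def)
  qed
qed (auto simp: arc_deficit_def dest: arc_verts)

lemma arc_inv_degree_sum_upper:
  assumes "0 < k" "\<And>v. v \<in> pverts G \<Longrightarrow> k \<le> vdegree G v"
  shows "arc_inv_degree_sum G \<le> real (card (pverts G)) / real k"
    and "arc_inv_degree_sum G = real (card (pverts G)) / real k \<longleftrightarrow> (\<forall>v\<in>pverts G. vdegree G v = k)"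
proof -
  have t: "0 \<le> arc_deficit k e" if e: "e \<in> parcs G" for e
  proof -
    obtain u v where [simp]: "e = (u, v)" by (cases e)
    have "real k \<le> real (vdegree G v)" using e assms(2)[of v] arc_verts by simp
    then have "1 / real (vdegree G v) \<le> 1 / real k" using assms(1) by (intro divide_left_mono) auto
    then show ?thesis by (simp add: arc_deficit_def)
  qed
  show "arc_inv_degree_sum G \<le> real (card (pverts G)) / real k"
    using sum_nonneg[of "parcs G" "arc_deficit k"] t by (simp add: sum_arc_deficit)
  show "arc_inv_degree_sum G = real (card (pverts G)) / real k \<longleftrightarrow> (\<forall>v\<in>pverts G. vdegree G v = k)"
    using sum_nonneg_eq_0_iff[of "parcs G" "arc_deficit k"] pair_finite_arcs t
    by (auto simp: degree_const_iff_arc_deficit[OF assms(1)] sum_arc_deficit)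
qed

lemma arc_inv_degree_sum_lower:
  assumes "0 < k" "\<And>v. v \<in> pverts G \<Longrightarrow> vdegree G v \<le> k"
  shows "real (card (pverts G)) / real k \<le> arc_inv_degree_sum G"
    and "arc_inv_degree_sum G = real (card (pverts G)) / real k \<longleftrightarrow> (\<forall>v\<in>pverts G. vdegree G v = k)"
proof -
  have t: "0 \<le> - arc_deficit k e" if e: "e \<in> parcs G" for e
  proof -
    obtain u v where [simp]: "e = (u, v)" by (cases e)
    have "real (vdegree G v) \<le> real k" "0 < real (vdegree G v)"
      using e assms(2)[of v] vdegree_pos[of v] arc_verts by auto
    then have "1 / real k \<le> 1 / real (vdegree G v)" by (intro divide_left_mono) auto
    then show ?thesis by (simp add: arc_deficit_def divide_nonpos_nonneg)
  qed
  show "real (card (pverts G)) / real k \<le> arc_inv_degree_sum G"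
    using sum_nonneg[of "parcs G" "\<lambda>e. - arc_deficit k e"] t by (simp add: sum_negf sum_arc_deficit)
  show "arc_inv_degree_sum G = real (card (pverts G)) / real k \<longleftrightarrow> (\<forall>v\<in>pverts G. vdegree G v = k)"
    using sum_nonneg_eq_0_iff[of "parcs G" "\<lambda>e. - arc_deficit k e"] pair_finite_arcs t
    by (auto simp: degree_const_iff_arc_deficit[OF assms(1)] sum_arc_deficit sum_negf)
qed

text \<open>
  With $a(v) = 1/d(v)$, the two arcs of an edge $uw$ have total deficit
  $a(u)(1 - a(w)) + a(w)(1 - a(u)) = a(w) + a(u)(1 - 2 a(w))$. If $d(w) \<ge> 2$ this is at least
  $a(w)$, so the $d(w)$ edges at $w$ alone have deficit at least 1. In the case of equality
  $a(w) = 1/2$ and no other arc has a deficit. A vertex $v \<noteq> w$ of degree at least 2 would have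
  a neighbour $u \<noteq> w$, and the arc from $u$ to $v$ would then have a positive deficit.
\<close>

lemma arc_inv_degree_sum_branching:
  assumes w: "w \<in> pverts G" "2 \<le> vdegree G w"
  shows "arc_inv_degree_sum G \<le> real (card (pverts G)) - 1"
    and "arc_inv_degree_sum G = real (card (pverts G)) - 1 \<Longrightarrow>
      vdegree G w = 2 \<and> (\<forall>v\<in>pverts G - {w}. vdegree G v = 1)"
proof -
  define a where "a v = 1 / real (vdegree G v)" for v
  define t where "t = arc_deficit 1"
  have t_eq: "t (u, v) = a u * (1 - a v)" for u v by (simp add: t_def arc_deficit_def a_def)
  define N where "N = parcs G `` {w}"
  define T where "T = (\<lambda>u. (u, w)) ` N \<union> Pair w ` N"
  have a: "0 < a v" "a v \<le> 1" if "v \<in> pverts G" for v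
    using vdegree_pos[OF that] by (auto simp: a_def)
  have aw: "a w \<le> 1 / 2" using w by (simp add: a_def field_simps)
  have N: "finite N" "w \<notin> N" "N \<subseteq> pverts G" and Na: "real (card N) * a w = 1"
    using finite_nbrs no_loops'[of w w] arc_verts vdegree_pos[OF w(1)]
    by (auto simp: N_def a_def vdegree_eq_card_nbrs)
  have "N \<noteq> {}" using Na by auto
  have TA: "T \<subseteq> parcs G" by (auto simp: T_def N_def intro: arcs_symmetric)
  have t: "0 \<le> t e" if "e \<in> parcs G" for e
  proof -
    obtain u v where e: "e = (u, v)" by (cases e)
    then have "0 < a u" "a v \<le> 1" using that arc_verts a by blast+
    then show ?thesis by (simp add: e t_eq)
  qed
  have "sum t T = (\<Sum>u\<in>N. t (u, w)) + (\<Sum>u\<in>N. t (w, u))"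
    unfolding T_def using N by (subst sum.union_disjoint) (auto simp: sum.reindex inj_on_def)
  also have "\<dots> = (\<Sum>u\<in>N. a w + a u * (1 - 2 * a w))"
    unfolding sum.distrib[symmetric] by (intro sum.cong) (auto simp: t_eq algebra_simps)
  also have "\<dots> = 1 + (\<Sum>u\<in>N. a u) * (1 - 2 * a w)"
    using Na by (simp add: sum.distrib sum_distrib_right)
  finally have T: "sum t T = 1 + (\<Sum>u\<in>N. a u) * (1 - 2 * a w)" .
  have sN: "0 < (\<Sum>u\<in>N. a u)" using N \<open>N \<noteq> {}\<close> a by (intro sum_pos) auto
  then have T1: "1 \<le> sum t T" using T aw by simp
  have split: "sum t (parcs G) = sum t (parcs G - T) + sum t T"
    using TA pair_finite_arcs by (rule sum.subset_diff)
  have rest: "0 \<le> sum t (parcs G - T)" using t by (intro sum_nonneg) auto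
  have d: "real (card (pverts G)) - arc_inv_degree_sum G = sum t (parcs G)"
    by (simp add: t_def sum_arc_deficit)
  show "arc_inv_degree_sum G \<le> real (card (pverts G)) - 1" using d split rest T1 by linarith
  assume "arc_inv_degree_sum G = real (card (pverts G)) - 1"
  then have "sum t T = 1" and "sum t (parcs G - T) = 0" using d split rest T1 by linarith+
  have "1 - 2 * a w = 0" using \<open>sum t T = 1\<close> T sN by simp
  then have w2: "vdegree G w = 2" by (simp add: a_def field_simps split: if_splits)
  have zero: "t e = 0" if "e \<in> parcs G - T" for e
    using \<open>sum t (parcs G - T) = 0\<close> t that pair_finite_arcs
    by (subst (asm) sum_nonneg_eq_0_iff) auto
  have "vdegree G v = 1" if v: "v \<in> pverts G" "v \<noteq> w" for v
  proof (cases "parcs G `` {v} \<subseteq> {w}")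
    case True
    then have "vdegree G v \<le> 1" unfolding vdegree_eq_card_nbrs
      using card_mono[of "{w}"] by fastforce
    then show ?thesis using vdegree_pos[OF v(1)] by simp
  next
    case False
    then obtain u where u: "(v, u) \<in> parcs G" "u \<noteq> w" by auto
    then have "t (u, v) = 0" using v by (intro zero) (auto simp: T_def intro: arcs_symmetric)
    moreover have "a u \<noteq> 0" using a[of u] u arc_verts by auto
    ultimately show ?thesis by (simp add: t_eq a_def split: if_splits)
  qed
  with w2 show "vdegree G w = 2 \<and> (\<forall>v\<in>pverts G - {w}. vdegree G v = 1)" by auto
qed

text \<open>
  Only arcs whose head is the branching vertex have a deficit: there are two of them, and each
  leaves a vertex of degree 1, so each has deficit $1 - 1/2$.
\<close>

lemma arc_inv_degree_sum_one_branching: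
  assumes w: "w \<in> pverts G" "vdegree G w = 2" and 1: "\<And>v. v \<in> pverts G \<Longrightarrow> v \<noteq> w \<Longrightarrow> vdegree G v = 1"
  shows "arc_inv_degree_sum G = real (card (pverts G)) - 1"
proof -
  define N where "N = parcs G `` {w}"
  have N: "(\<lambda>u. (u, w)) ` N \<subseteq> parcs G" "N \<subseteq> pverts G - {w}" "card N = 2"
    using w no_loops'[of w w] arc_verts by (auto simp: N_def vdegree_eq_card_nbrs intro: arcs_symmetric)
  have zero: "arc_deficit 1 e = 0" if "e \<in> parcs G - (\<lambda>u. (u, w)) ` N" for e
  proof -
    obtain u v where e: "e = (u, v)" by (cases e)
    with that have "v \<noteq> w" by (auto simp: N_def dest: arcs_symmetric)
    then have "vdegree G v = 1" using 1 that arc_verts e by blast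
    then show ?thesis by (simp add: e arc_deficit_def)
  qed
  have "sum (arc_deficit 1) (parcs G) = sum (arc_deficit 1) ((\<lambda>u. (u, w)) ` N)"
    using N(1) pair_finite_arcs zero by (intro sum.mono_neutral_right) auto
  also have "\<dots> = (\<Sum>u\<in>N. arc_deficit 1 (u, w))"
    by (subst sum.reindex) (auto simp: inj_on_def)
  also have "\<dots> = (\<Sum>u\<in>N. 1 / 2)"
  proof (intro sum.cong refl)
    fix u assume "u \<in> N"
    then have "vdegree G u = 1" using N(2) 1 by blast
    then show "arc_deficit 1 (u, w) = 1 / 2" using w(2) by (simp add: arc_deficit_def)
  qed
  also have "\<dots> = 1" using N(3) by simp
  finally show ?thesis by (simp add: sum_arc_deficit)
qed

end

section \<open>Disjoint unions of short paths\<close>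

lemma path_graph_1_iff:
  "path_graph 1 P \<longleftrightarrow> (\<exists>a b. a \<noteq> b \<and> pverts P = {a, b} \<and> parcs P = {(a, b), (b, a)})"
proof -
  have len: "length xs = Suc 1 \<longleftrightarrow> (\<exists>a b. xs = [a, b])" for xs :: "'a list"
    by (auto simp: length_Suc_conv)
  have arcs: "{(xs ! i, xs ! Suc i) | i. i < 1} = {(xs ! 0, xs ! 1)}"
    "{(xs ! Suc i, xs ! i) | i. i < 1} = {(xs ! 1, xs ! 0)}" for xs :: "'a list"
    by auto
  have "path_graph 1 P \<longleftrightarrow> (\<exists>a b. distinct [a, b] \<and> pverts P = set [a, b] \<and>
      parcs P = {([a, b] ! 0, [a, b] ! 1)} \<union> {([a, b] ! 1, [a, b] ! 0)})"
    unfolding path_graph_def len arcs by blast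
  also have "\<dots> \<longleftrightarrow> (\<exists>a b. a \<noteq> b \<and> pverts P = {a, b} \<and> parcs P = {(a, b), (b, a)})"
    by (simp add: insert_commute)
  finally show ?thesis .
qed

lemma path_graph_2_iff:
  "path_graph 2 P \<longleftrightarrow> (\<exists>a w b. distinct [a, w, b] \<and> pverts P = {a, w, b} \<and>
     parcs P = {(a, w), (w, b), (w, a), (b, w)})"
proof -
  have len: "length xs = Suc 2 \<longleftrightarrow> (\<exists>a w b. xs = [a, w, b])" for xs :: "'a list"
    by (auto simp: length_Suc_conv numeral_2_eq_2)
  have arcs: "{(xs ! i, xs ! Suc i) | i. i < 2} = {(xs ! 0, xs ! 1), (xs ! 1, xs ! 2)}"
    "{(xs ! Suc i, xs ! i) | i. i < 2} = {(xs ! 1, xs ! 0), (xs ! 2, xs ! 1)}" for xs :: "'a list"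
    by (auto simp: numeral_2_eq_2 less_Suc_eq)
  have "path_graph 2 P \<longleftrightarrow> (\<exists>a w b. distinct [a, w, b] \<and> pverts P = set [a, w, b] \<and>
      parcs P = {([a, w, b] ! 0, [a, w, b] ! 1), ([a, w, b] ! 1, [a, w, b] ! 2)} \<union>
        {([a, w, b] ! 1, [a, w, b] ! 0), ([a, w, b] ! 2, [a, w, b] ! 1)})"
    unfolding path_graph_def len arcs by blast
  moreover have "{([a, w, b] ! 0, [a, w, b] ! 1), ([a, w, b] ! 1, [a, w, b] ! 2)} \<union>
        {([a, w, b] ! 1, [a, w, b] ! 0), ([a, w, b] ! 2, [a, w, b] ! 1)}
      = {(a, w), (w, b), (w, a), (b, w)}" for a w b :: 'a
    by auto
  ultimately show ?thesis by (simp only: list.set)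
qed

text \<open>
  Disjointness leaves a vertex in one component only, and all arcs at it belong to that component.
\<close>

lemma is_disjoint_union_vdegree:
  assumes U: "is_disjoint_union G Hs" and H: "H \<in> set Hs" "v \<in> pverts H"
    and wf: "\<And>H. H \<in> set Hs \<Longrightarrow> parcs H \<subseteq> pverts H \<times> pverts H"
  shows "vdegree G v = vdegree H v"
proof -
  have "H' = H" if "H' \<in> set Hs" "(v, u) \<in> parcs H'" for H' u
  proof -
    have "v \<in> pverts H'" using wf that by auto
    with U H that(1) show ?thesis
      unfolding is_disjoint_union_def by (metis IntI empty_iff in_set_conv_nth)
  qed
  then have "parcs G `` {v} = parcs H `` {v}"
    using U H unfolding is_disjoint_union_def by auto
  then show ?thesis by (simp add: vdegree_eq_card_nbrs)
qed

lemma is_disjoint_union_Cons: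
  assumes "is_disjoint_union \<lparr>pverts = V, parcs = E\<rparr> Hs" "pverts H \<inter> V = {}"
  shows "is_disjoint_union \<lparr>pverts = pverts H \<union> V, parcs = parcs H \<union> E\<rparr> (H # Hs)"
proof -
  have V: "V = (\<Union>H\<in>set Hs. pverts H)" using assms(1) by (simp add: is_disjoint_union_def)
  have "pverts H \<inter> pverts (Hs ! i) = {}" if "i < length Hs" for i
    using assms(2) nth_mem[OF that] unfolding V by blast
  then show ?thesis
    using assms(1) unfolding is_disjoint_union_def
    by (auto simp: nth_Cons Int_commute split: nat.splits)
qed

text \<open>
  By induction: a vertex together with its only neighbour is one component, and deleting both
  leaves a 1-regular graph. The statement speaks of a vertex set and a relation because the
  induction runs through such remainders.
\<close>

lemma one_regular_decomposition:
  assumes "finite V" "E \<subseteq> V \<times> V" "sym E" "irrefl E" "\<And>v. v \<in> V \<Longrightarrow> card (E `` {v}) = 1"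
  shows "\<exists>Hs. 2 * length Hs = card V \<and> (\<forall>H\<in>set Hs. path_graph 1 H) \<and>
    is_disjoint_union \<lparr>pverts = V, parcs = E\<rparr> Hs"
  using assms
proof (induction "card V" arbitrary: V E rule: less_induct)
  case less
  show ?case
  proof (cases "V = {}")
    case True
    then show ?thesis using less.prems by (intro exI[of _ "[]"]) (auto simp: is_disjoint_union_def)
  next
    case False
    then obtain a where a: "a \<in> V" by auto
    with less.prems(5) obtain b where Ea: "E `` {a} = {b}" by (meson card_1_singletonE)
    then have ab: "(a, b) \<in> E" "(b, a) \<in> E" using less.prems(3) by (auto dest: symD)
    then have b: "b \<in> V" "a \<noteq> b" using less.prems by (auto simp: irrefl_def)
    have "(b, x) \<in> E \<Longrightarrow> x = a" for x
      using less.prems(5)[OF b(1)] ab(2) by (metis Image_singleton_iff card_1_singletonE singletonD)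
    with ab have Eb: "E `` {b} = {a}" by blast
    define V' E' where "V' = V - {a, b}" and "E' = E \<inter> V' \<times> V'"
    let ?H = "\<lparr>pverts = {a, b}, parcs = {(a, b), (b, a)}\<rparr>"
    have nbr: "x \<in> V'" if "v \<in> V'" "(v, x) \<in> E" for v x
    proof -
      have "(x, v) \<in> E" "x \<in> V" using that(2) less.prems(2,3) by (auto dest: symD)
      then show ?thesis using that(1) Ea Eb by (auto simp: V'_def)
    qed
    have E'v: "E' `` {v} = E `` {v}" if "v \<in> V'" for v
      using nbr that by (auto simp: E'_def)
    have E: "E = {(a, b), (b, a)} \<union> E'"
    proof
      show "E \<subseteq> {(a, b), (b, a)} \<union> E'"
      proof (rule subrelI)
        fix x y assume xy: "(x, y) \<in> E"
        show "(x, y) \<in> {(a, b), (b, a)} \<union> E'"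
        proof (cases "x \<in> V'")
          case True
          then show ?thesis using nbr xy by (simp add: E'_def)
        next
          case False
          then have "x = a \<or> x = b" using xy less.prems(2) by (auto simp: V'_def)
          then show ?thesis using xy Ea Eb by blast
        qed
      qed
    qed (use ab in \<open>auto simp: E'_def\<close>)
    have card: "card V = card V' + 2"
    proof -
      have "card {a, b} \<le> card V" using a b less.prems(1) by (intro card_mono) auto
      then show ?thesis using a b less.prems(1) by (simp add: V'_def card_Diff_subset)
    qed
    have "\<exists>Hs. 2 * length Hs = card V' \<and> (\<forall>H\<in>set Hs. path_graph 1 H) \<and>
        is_disjoint_union \<lparr>pverts = V', parcs = E'\<rparr> Hs"
    proof (rule less.hyps)
      show "card V' < card V" using card by simp
      show "card (E' `` {v}) = 1" if "v \<in> V'" for v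
        using less.prems(5)[of v] that by (simp add: E'v V'_def)
    qed (use less.prems in \<open>auto simp: V'_def E'_def sym_def irrefl_def\<close>)
    then obtain Hs where Hs: "2 * length Hs = card V'" "\<forall>H\<in>set Hs. path_graph 1 H"
      "is_disjoint_union \<lparr>pverts = V', parcs = E'\<rparr> Hs" by blast
    have "V = {a, b} \<union> V'" using a b by (auto simp: V'_def)
    then have "is_disjoint_union \<lparr>pverts = V, parcs = E\<rparr> (?H # Hs)"
      using is_disjoint_union_Cons[OF Hs(3), of ?H] E by (simp add: V'_def)
    moreover have "path_graph 1 ?H" unfolding path_graph_1_iff using b by auto
    ultimately show ?thesis using Hs card by (intro exI[of _ "?H # Hs"]) auto
  qed
qed

context isolated_free_graph
begin

lemma simple_arcs: "parcs G \<subseteq> pverts G \<times> pverts G" "sym (parcs G)" "irrefl (parcs G)"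
proof -
  show "sym (parcs G)" by (rule symI) (rule arcs_symmetric)
qed (use arc_verts no_loops' in \<open>auto simp: irrefl_def\<close>)

lemma graph_record_eta: "\<lparr>pverts = pverts G, parcs = parcs G\<rparr> = G"
  by (rule pair_pre_digraph.equality) simp_all

lemma one_regular_iff_matching:
  "(\<forall>v\<in>pverts G. vdegree G v = 1) \<longleftrightarrow>
   (\<exists>Hs. 2 * length Hs = card (pverts G) \<and> (\<forall>H\<in>set Hs. path_graph 1 H) \<and> is_disjoint_union G Hs)"
proof
  assume "\<forall>v\<in>pverts G. vdegree G v = 1"
  then show "\<exists>Hs. 2 * length Hs = card (pverts G) \<and> (\<forall>H\<in>set Hs. path_graph 1 H) \<and> is_disjoint_union G Hs"
    using one_regular_decomposition[OF pair_finite_verts simple_arcs] by (simp add: vdegree_eq_card_nbrs graph_record_eta)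
next
  assume "\<exists>Hs. 2 * length Hs = card (pverts G) \<and> (\<forall>H\<in>set Hs. path_graph 1 H) \<and> is_disjoint_union G Hs"
  then obtain Hs where Hs: "\<And>H. H \<in> set Hs \<Longrightarrow> path_graph 1 H" "is_disjoint_union G Hs" by blast
  show "\<forall>v\<in>pverts G. vdegree G v = 1"
  proof
    fix v assume "v \<in> pverts G"
    then obtain H where H: "H \<in> set Hs" "v \<in> pverts H" using Hs(2) by (auto simp: is_disjoint_union_def)
    have deg: "vdegree G v = vdegree H v"
    proof (rule is_disjoint_union_vdegree[OF Hs(2) H])
      show "parcs K \<subseteq> pverts K \<times> pverts K" if "K \<in> set Hs" for K
        using Hs(1)[OF that] unfolding path_graph_1_iff by auto
    qed
    obtain a b where ab: "a \<noteq> b" "pverts H = {a, b}" "parcs H = {(a, b), (b, a)}"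
      using Hs(1)[OF H(1)] unfolding path_graph_1_iff by auto
    have "parcs H `` {v} = (if v = a then {b} else {a})" using ab H(2) by auto
    then show "vdegree G v = 1" unfolding deg by (simp add: vdegree_eq_card_nbrs)
  qed
qed

text \<open>
  The two neighbours $a$, $b$ of the vertex $w$ of degree 2 have degree 1, so $a$, $w$, $b$ span
  a component that is a path of length 2; the rest of the graph is 1-regular.
\<close>

lemma one_branching_iff_path_2:
  "(\<exists>w\<in>pverts G. vdegree G w = 2 \<and> (\<forall>v\<in>pverts G - {w}. vdegree G v = 1)) \<longleftrightarrow>
   (\<exists>P Hs. path_graph 2 P \<and> 2 * length Hs + 3 = card (pverts G) \<and>
      (\<forall>H\<in>set Hs. path_graph 1 H) \<and> is_disjoint_union G (P # Hs))"
  (is "?L \<longleftrightarrow> ?R")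
proof
  assume ?L
  then obtain w where w: "w \<in> pverts G" "vdegree G w = 2"
    and 1: "\<And>v. v \<in> pverts G \<Longrightarrow> v \<noteq> w \<Longrightarrow> card (parcs G `` {v}) = 1"
    by (auto simp: vdegree_eq_card_nbrs)
  obtain a b where Ew: "parcs G `` {w} = {a, b}" "a \<noteq> b"
    using w(2) by (auto simp: vdegree_eq_card_nbrs card_2_iff)
  then have arcs: "(w, a) \<in> parcs G" "(w, b) \<in> parcs G" "(a, w) \<in> parcs G" "(b, w) \<in> parcs G"
    using arcs_symmetric by blast+
  then have ne: "a \<noteq> w" "b \<noteq> w" and V: "a \<in> pverts G" "b \<in> pverts G"
    using no_loops' arc_verts by blast+
  have "(x, y) \<in> parcs G \<Longrightarrow> x \<in> {a, b} \<Longrightarrow> y = w" for x y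
    using 1[of x] V ne arcs by (metis Image_singleton_iff card_1_singletonE insertE singletonD)
  with arcs have Eab: "parcs G `` {a} = {w}" "parcs G `` {b} = {w}" by blast+
  define V' E' where "V' = pverts G - {a, w, b}" and "E' = parcs G \<inter> V' \<times> V'"
  let ?P = "\<lparr>pverts = {a, w, b}, parcs = {(a, w), (w, b), (w, a), (b, w)}\<rparr>"
  have nbr: "x \<in> V'" if "v \<in> V'" "(v, x) \<in> parcs G" for v x
    using that(1) arc_verts[OF that(2)] arcs_symmetric[OF that(2)] Ew Eab by (auto simp: V'_def)
  have E'v: "E' `` {v} = parcs G `` {v}" if "v \<in> V'" for v
    using nbr that by (auto simp: E'_def)
  have E: "parcs G = {(a, w), (w, b), (w, a), (b, w)} \<union> E'"
  proof
    show "parcs G \<subseteq> {(a, w), (w, b), (w, a), (b, w)} \<union> E'"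
    proof (rule subrelI)
      fix x y assume xy: "(x, y) \<in> parcs G"
      show "(x, y) \<in> {(a, w), (w, b), (w, a), (b, w)} \<union> E'"
      proof (cases "x \<in> V'")
        case True
        then show ?thesis using nbr xy by (auto simp: E'_def)
      next
        case False
        then show ?thesis using xy arc_verts[OF xy] Ew Eab by (auto simp: V'_def)
      qed
    qed
  qed (use arcs in \<open>auto simp: E'_def\<close>)
  have card: "card (pverts G) = card V' + 3"
  proof -
    have "card {a, w, b} \<le> card (pverts G)" using w V pair_finite_verts by (intro card_mono) auto
    then show ?thesis using w V ne Ew(2) pair_finite_verts by (simp add: V'_def card_Diff_subset)
  qed
  have "\<exists>Hs. 2 * length Hs = card V' \<and> (\<forall>H\<in>set Hs. path_graph 1 H) \<and>
      is_disjoint_union \<lparr>pverts = V', parcs = E'\<rparr> Hs"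
  proof (rule one_regular_decomposition)
    show "card (E' `` {v}) = 1" if "v \<in> V'" for v
      using 1[of v] that by (simp add: E'v V'_def)
  qed (use simple_arcs pair_finite_verts in \<open>auto simp: V'_def E'_def sym_def irrefl_def\<close>)
  then obtain Hs where Hs: "2 * length Hs = card V'" "\<forall>H\<in>set Hs. path_graph 1 H"
    "is_disjoint_union \<lparr>pverts = V', parcs = E'\<rparr> Hs" by blast
  have "pverts G = {a, w, b} \<union> V'" using w V by (auto simp: V'_def)
  then have "G = \<lparr>pverts = {a, w, b} \<union> V', parcs = {(a, w), (w, b), (w, a), (b, w)} \<union> E'\<rparr>"
    using E by simp
  then have "is_disjoint_union G (?P # Hs)"
    using is_disjoint_union_Cons[OF Hs(3), of ?P] by (simp add: V'_def)
  moreover have "path_graph 2 ?P"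
    unfolding path_graph_2_iff using ne Ew(2) by (intro exI[of _ a] exI[of _ w] exI[of _ b]) auto
  ultimately show ?R
    using Hs card by (intro exI[of _ ?P] exI[of _ Hs]) auto
next
  assume ?R
  then obtain P Hs where P: "path_graph 2 P" and Hs: "\<And>H. H \<in> set Hs \<Longrightarrow> path_graph 1 H"
    and U: "is_disjoint_union G (P # Hs)" by blast
  obtain a w b where awb: "distinct [a, w, b]" "pverts P = {a, w, b}"
    "parcs P = {(a, w), (w, b), (w, a), (b, w)}"
    using P unfolding path_graph_2_iff by auto
  have wf: "parcs H \<subseteq> pverts H \<times> pverts H" if "H \<in> set (P # Hs)" for H
  proof (cases "H = P")
    case False
    then show ?thesis using Hs[of H] that unfolding path_graph_1_iff by auto
  qed (use awb in auto)
  have deg: "vdegree G v = vdegree H v" if "H \<in> set (P # Hs)" "v \<in> pverts H" for H v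
    by (rule is_disjoint_union_vdegree[OF U that wf])
  have "parcs P `` {w} = {a, b}" "parcs P `` {a} = {w}" "parcs P `` {b} = {w}" using awb by auto
  then have P_deg: "vdegree P w = 2" "vdegree P a = 1" "vdegree P b = 1"
    using awb(1) by (auto simp: vdegree_eq_card_nbrs)
  have "vdegree G v = 1" if v: "v \<in> pverts G" "v \<noteq> w" for v
  proof -
    obtain H where H: "H \<in> set (P # Hs)" "v \<in> pverts H" using U v by (auto simp: is_disjoint_union_def)
    show ?thesis
    proof (cases "H = P")
      case True
      then show ?thesis using deg[OF H] P_deg H awb v by auto
    next
      case False
      then obtain c d where cd: "c \<noteq> d" "pverts H = {c, d}" "parcs H = {(c, d), (d, c)}"
        using Hs[of H] H unfolding path_graph_1_iff by auto
      have "parcs H `` {v} = (if v = c then {d} else {c})" using cd H(2) by auto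
      then show ?thesis using deg[OF H] by (simp add: vdegree_eq_card_nbrs)
    qed
  qed
  moreover have "w \<in> pverts G" using U awb by (auto simp: is_disjoint_union_def)
  moreover have "vdegree G w = 2" using deg[of P w] P_deg awb by simp
  ultimately show ?L by blast
qed

end

section \<open>The normalized Laplacians\<close>

lemma normalized_matrix_index:
  assumes "i < length vs" "j < length vs" and X: "X \<in> carrier_mat (length vs) (length vs)"
  shows "(inv_sqrt_degree_matrix G vs * X * inv_sqrt_degree_matrix G vs) $$ (i, j)
    = X $$ (i, j) / (sqrt (vdegree G (vs ! i)) * sqrt (vdegree G (vs ! j)))"
  using assms unfolding inv_sqrt_degree_matrix_def
  by (subst mat_diag_mult_left[OF X]) (simp add: mat_diag_mult_right[of _ "length vs"])

context isolated_free_graph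
begin

definition arc_ind :: "'a list \<Rightarrow> nat \<Rightarrow> nat \<Rightarrow> real" where
  "arc_ind vs i j = (if (vs ! i, vs ! j) \<in> parcs G then 1 else 0)"

lemma arc_ind_sym: "arc_ind vs i j = arc_ind vs j i"
proof -
  have "(vs ! i, vs ! j) \<in> parcs G \<longleftrightarrow> (vs ! j, vs ! i) \<in> parcs G"
    using arcs_symmetric by blast
  then show ?thesis by (simp add: arc_ind_def)
qed

text \<open>
  Both normalized Laplacians have ones on the diagonal and differ only in the sign $\<sigma>$ of the
  other entries, so a single computation covers both of them.
\<close>

definition normalized_entries :: "real \<Rightarrow> 'a list \<Rightarrow> real mat \<Rightarrow> bool" where
  "normalized_entries \<sigma> vs M \<longleftrightarrow> M \<in> carrier_mat (length vs) (length vs) \<and>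
     (\<forall>i<length vs. \<forall>j<length vs. M $$ (i, j) = (if i = j then 1 else 0) +
        \<sigma> * arc_ind vs i j / (sqrt (vdegree G (vs ! i)) * sqrt (vdegree G (vs ! j))))"

lemma normalized_entriesI:
  assumes vs: "set vs = pverts G" and X: "X \<in> carrier_mat (length vs) (length vs)"
    and entry: "\<And>i j. i < length vs \<Longrightarrow> j < length vs \<Longrightarrow>
      X $$ (i, j) = (if i = j then real (vdegree G (vs ! i)) else 0) + \<sigma> * arc_ind vs i j"
  shows "normalized_entries \<sigma> vs (inv_sqrt_degree_matrix G vs * X * inv_sqrt_degree_matrix G vs)"
  unfolding normalized_entries_def
proof (intro conjI allI impI)
  fix i j assume ij: "i < length vs" "j < length vs"
  have "0 < vdegree G (vs ! i)" using vdegree_pos ij(1) vs nth_mem by blast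
  then have "(if i = j then real (vdegree G (vs ! i)) else 0) / (sqrt (vdegree G (vs ! i)) * sqrt (vdegree G (vs ! j)))
      = (if i = j then 1 else 0)"
    by auto
  then show "(inv_sqrt_degree_matrix G vs * X * inv_sqrt_degree_matrix G vs) $$ (i, j)
      = (if i = j then 1 else 0) + \<sigma> * arc_ind vs i j / (sqrt (vdegree G (vs ! i)) * sqrt (vdegree G (vs ! j)))"
    unfolding normalized_matrix_index[OF ij X] entry[OF ij] add_divide_distrib by (simp only:)
qed (rule carrier_matI; simp add: inv_sqrt_degree_matrix_def mat_diag_def)

lemma normalized_entries_laplacians:
  assumes "set vs = pverts G"
  shows "normalized_entries (-1) vs (normalized_laplacian G vs)"
    and "normalized_entries 1 vs (normalized_signless_laplacian G vs)"
proof -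
  have A: "adjacency_matrix G vs \<in> carrier_mat (length vs) (length vs)"
    by (simp add: adjacency_matrix_def)
  show "normalized_entries (-1) vs (normalized_laplacian G vs)"
    unfolding normalized_laplacian_def
    by (rule normalized_entriesI[OF assms minus_carrier_mat[OF A]])
      (simp add: degree_matrix_def adjacency_matrix_def arc_ind_def mat_diag_def)
  show "normalized_entries 1 vs (normalized_signless_laplacian G vs)"
    unfolding normalized_signless_laplacian_def
    by (rule normalized_entriesI[OF assms add_carrier_mat[OF A]])
      (simp add: degree_matrix_def adjacency_matrix_def arc_ind_def mat_diag_def)
qed

context
  fixes vs :: "'a list" and n :: nat and \<sigma> :: real and M :: "real mat"
  assumes vs: "distinct vs" "set vs = pverts G" and n: "n = length vs"
    and sign: "\<sigma> = 1 \<or> \<sigma> = -1" and M: "normalized_entries \<sigma> vs M"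
begin

private lemma n_eq: "n = card (pverts G)"
  using distinct_card[OF vs(1)] vs(2) n by simp

private lemma sum_index: "(\<Sum>i<n. f (vs ! i)) = (\<Sum>v\<in>pverts G. f v)" for f :: "'a \<Rightarrow> real"
  by (rule sum.reindex_bij_betw[OF bij_betw_nth]) (use vs n in auto)

private lemma sum_arc_ind:
  "(\<Sum>i<n. \<Sum>j<n. arc_ind vs i j * f (vs ! i) (vs ! j)) = (\<Sum>(u, v)\<in>parcs G. f u v)"
proof -
  have "(\<Sum>j<n. arc_ind vs i j * f (vs ! i) (vs ! j)) = (\<Sum>v\<in>parcs G `` {vs ! i}. f (vs ! i) v)" for i
  proof -
    have "(\<Sum>j<n. arc_ind vs i j * f (vs ! i) (vs ! j))
        = (\<Sum>v\<in>pverts G. if (vs ! i, v) \<in> parcs G then f (vs ! i) v else 0)"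
      unfolding sum_index[symmetric] by (intro sum.cong) (auto simp: arc_ind_def)
    also have "\<dots> = (\<Sum>v\<in>parcs G `` {vs ! i}. f (vs ! i) v)"
      using pair_finite_verts arc_verts by (intro sum.mono_neutral_cong_right) auto
    finally show ?thesis .
  qed
  then show ?thesis
    using sum_index[of "\<lambda>u. \<Sum>v\<in>parcs G `` {u}. f u v"] by (simp add: sum_arcs_conv)
qed

private lemma sum_arc_ind_row: "(\<Sum>j<n. arc_ind vs i j) = real (vdegree G (vs ! i))"
proof -
  have "(\<Sum>j<n. arc_ind vs i j) = (\<Sum>v\<in>pverts G. if (vs ! i, v) \<in> parcs G then 1 else 0)"
    unfolding sum_index[symmetric] by (intro sum.cong) (auto simp: arc_ind_def)
  also have "\<dots> = (\<Sum>v\<in>parcs G `` {vs ! i}. 1)"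
    using pair_finite_verts arc_verts by (intro sum.mono_neutral_cong_right) auto
  finally show ?thesis by (simp add: vdegree_eq_card_nbrs)
qed

private lemma deg_pos: "i < n \<Longrightarrow> 0 < vdegree G (vs ! i)"
  using vdegree_pos[of "vs ! i"] vs(2) n nth_mem[of i vs] by simp

text \<open>
  Since $\<sigma>^2 = 1$ and every row $i$ has $d_i$ arcs, completing squares arc by arc writes the form as
  $(1/2) \<Sum> (x_i / \<surd>d_i + \<sigma> x_j / \<surd>d_j)^2$ over the arcs $(i,j)$.
\<close>

lemma psd_normalized: "psd_mat n M"
proof -
  define s where "s i = 1 / sqrt (vdegree G (vs ! i))" for i
  have entry: "M $$ (i, j) = (if i = j then 1 else 0) + \<sigma> * arc_ind vs i j * s i * s j"
    if "i < n" "j < n" for i j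
    using M that n by (simp add: normalized_entries_def s_def)
  have ds: "(s i)\<^sup>2 * real (vdegree G (vs ! i)) = 1" if "i < n" for i
    using deg_pos[OF that] by (simp add: s_def power_divide)
  have form: "(\<Sum>i<n. \<Sum>j<n. x i * M $$ (i, j) * x j)
      = (\<Sum>i<n. \<Sum>j<n. arc_ind vs i j * (s i * x i + \<sigma> * s j * x j)\<^sup>2) / 2" (is "_ = ?R / 2") for x :: "nat \<Rightarrow> real"
  proof -
    define X where "X = (\<Sum>i<n. (x i)\<^sup>2)"
    define C where "C = (\<Sum>i<n. \<Sum>j<n. arc_ind vs i j * (s i * x i * s j * x j))"
    have row: "(\<Sum>i<n. \<Sum>j<n. arc_ind vs i j * (s i * x i)\<^sup>2) = X"
      unfolding X_def
    proof (intro sum.cong refl)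
      fix i assume "i \<in> {..<n}"
      then show "(\<Sum>j<n. arc_ind vs i j * (s i * x i)\<^sup>2) = (x i)\<^sup>2"
        using ds[of i] by (simp add: power_mult_distrib sum_arc_ind_row mult.commute flip: sum_distrib_right)
    qed
    have col: "(\<Sum>i<n. \<Sum>j<n. arc_ind vs i j * (s j * x j)\<^sup>2) = X"
      unfolding row[symmetric] by (subst sum.swap) (simp only: arc_ind_sym)
    have "arc_ind vs i j * (s i * x i + \<sigma> * s j * x j)\<^sup>2
        = arc_ind vs i j * (s i * x i)\<^sup>2 + arc_ind vs i j * (s j * x j)\<^sup>2
          + (2 * \<sigma>) * (arc_ind vs i j * (s i * x i * s j * x j))" for i j
      using sign by (auto simp: power2_eq_square algebra_simps)
    then have "?R = X + X + (2 * \<sigma>) * C"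
      by (simp add: sum.distrib row col C_def flip: sum_distrib_left)
    moreover have "(\<Sum>i<n. \<Sum>j<n. x i * M $$ (i, j) * x j) = X + \<sigma> * C"
    proof -
      have "(\<Sum>j<n. x i * M $$ (i, j) * x j)
          = (x i)\<^sup>2 + \<sigma> * (\<Sum>j<n. arc_ind vs i j * (s i * x i * s j * x j))" if "i < n" for i
      proof -
        have "(\<Sum>j<n. x i * M $$ (i, j) * x j) = (\<Sum>j<n. (if i = j then (x i)\<^sup>2 else 0)
            + \<sigma> * (arc_ind vs i j * (s i * x i * s j * x j)))"
          using that by (intro sum.cong refl) (auto simp: entry power2_eq_square algebra_simps)
        then show ?thesis using that by (simp add: sum.distrib sum_distrib_left)
      qed
      then show ?thesis by (simp add: X_def C_def sum.distrib sum_distrib_left)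
    qed
    ultimately show ?thesis by simp
  qed
  have nonneg: "0 \<le> (\<Sum>i<n. \<Sum>j<n. x i * M $$ (i, j) * x j)" for x :: "nat \<Rightarrow> real"
    unfolding form by (simp add: arc_ind_def sum_nonneg)
  have sym: "M $$ (i, j) = M $$ (j, i)" if "i < n" "j < n" for i j
    using that by (simp add: entry arc_ind_sym[of vs i j])
  have "M \<in> carrier_mat n n" using M n by (simp add: normalized_entries_def)
  then show ?thesis unfolding psd_mat_def by (intro conjI allI impI sym nonneg)
qed

lemma trace_normalized: "trace_mat M = real n"
proof -
  have "arc_ind vs i i = 0" for i using no_loops' by (auto simp: arc_ind_def)
  then have diag: "M $$ (i, i) = 1" if "i < n" for i
    using M that n by (simp add: normalized_entries_def)
  have "dim_row M = n" using M n by (auto simp: normalized_entries_def)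
  then have "trace_mat M = (\<Sum>i<n. M $$ (i, i))" by (simp add: trace_mat_def)
  also have "\<dots> = (\<Sum>i<n. 1)" by (intro sum.cong refl diag) simp
  finally show ?thesis by simp
qed

text \<open>
  The diagonal of $M$ contributes $n$; an arc contributes the square of
  $\<sigma> / \<surd>(d_i d_j)$, in which the sign disappears.
\<close>

lemma trace_normalized_sq: "trace_mat (M * M) = real n + arc_inv_degree_sum G"
proof -
  have MC: "M \<in> carrier_mat n n" using M n by (simp add: normalized_entries_def)
  have "M $$ (i, j) * M $$ (j, i) = (if i = j then 1 else 0)
      + arc_ind vs i j * (1 / (real (vdegree G (vs ! i)) * real (vdegree G (vs ! j))))"
    if ij: "i < n" "j < n" for i j
  proof (cases "i = j")
    case True
    then have "arc_ind vs i j = 0" using no_loops' by (auto simp: arc_ind_def)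
    then show ?thesis using M ij n True by (simp add: normalized_entries_def)
  next
    case False
    let ?d = "sqrt (vdegree G (vs ! i)) * sqrt (vdegree G (vs ! j))"
    have "M $$ (i, j) = \<sigma> * arc_ind vs i j / ?d" "M $$ (j, i) = \<sigma> * arc_ind vs i j / ?d"
      using M ij n False arc_ind_sym[of vs i j] by (auto simp: normalized_entries_def mult.commute)
    then have "M $$ (i, j) * M $$ (j, i) = \<sigma>\<^sup>2 * (arc_ind vs i j)\<^sup>2 / ?d\<^sup>2"
      by (simp add: power2_eq_square)
    moreover have "\<sigma>\<^sup>2 = 1" using sign by auto
    moreover have "(arc_ind vs i j)\<^sup>2 = arc_ind vs i j" by (simp add: arc_ind_def)
    moreover have "?d\<^sup>2 = real (vdegree G (vs ! i)) * real (vdegree G (vs ! j))"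
      by (simp add: power_mult_distrib)
    ultimately show ?thesis using False by simp
  qed
  then have "trace_mat (M * M) = (\<Sum>i<n. \<Sum>j<n. (if i = j then 1 else 0)
      + arc_ind vs i j * (1 / (real (vdegree G (vs ! i)) * real (vdegree G (vs ! j)))))"
    unfolding trace_mat_mult[OF MC MC] by (intro sum.cong refl) auto
  also have "\<dots> = (\<Sum>i<n. \<Sum>j<n. if i = j then 1 else 0)
      + (\<Sum>i<n. \<Sum>j<n. arc_ind vs i j * (1 / (real (vdegree G (vs ! i)) * real (vdegree G (vs ! j)))))"
    by (simp only: sum.distrib)
  also have "(\<Sum>i<n. \<Sum>j<n. if i = j then 1 else 0) = real n"
    by simp
  also have "(\<Sum>i<n. \<Sum>j<n. arc_ind vs i j * (1 / (real (vdegree G (vs ! i)) * real (vdegree G (vs ! j)))))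
      = arc_inv_degree_sum G"
    unfolding arc_inv_degree_sum_def
    by (rule sum_arc_ind[of "\<lambda>u v. 1 / (real (vdegree G u) * real (vdegree G v))"])
  finally show ?thesis .
qed

text \<open>
  The entropy depends on the graph only through $n$ and the arc sum, and is the same for both
  Laplacians.
\<close>

lemma entropy1_normalized:
  assumes "pverts G \<noteq> {}"
  shows "entropy1 M = 1 - 1 / real n - arc_inv_degree_sum G / (real n)\<^sup>2"
proof -
  have "0 < n" using assms pair_finite_verts by (simp add: n_eq card_gt_0_iff)
  then show ?thesis
    using entropy1_psd[OF psd_normalized]
    by (simp add: trace_normalized trace_normalized_sq add_divide_distrib power2_eq_square)
qed

end

end

theorem corollary3p4:
  fixes G :: "'a pair_pre_digraph" and vs :: "'a list" and n m :: nat and I :: real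
  assumes "pair_graph G"
    and "n = card (pverts G)" and "n \<ge> 1"
    and "m = card (edges G)"
    and "\<forall>v \<in> pverts G. \<not> isolated G v"
    and "distinct vs" and "set vs = pverts G"
    and "I = entropy1 (normalized_laplacian G vs) \<or>
         I = entropy1 (normalized_signless_laplacian G vs)"
  shows
    "(odd n \<longrightarrow> 1 - 2 / real n + 1 / (real n)\<^sup>2 \<le> I \<and> I \<le> 1 - 1 / (real n - 1)) \<and>
     (even n \<longrightarrow> 1 - 2 / real n \<le> I \<and> I \<le> 1 - 1 / (real n - 1)) \<and>
     (I = 1 - 1 / (real n - 1) \<longleftrightarrow> complete_digraph n (with_proj G)) \<and>
     (even n \<longrightarrow>
        (I = 1 - 2 / real n \<longleftrightarrow>
          (\<exists>Hs. length Hs = n div 2 \<and> (\<forall>H \<in> set Hs. path_graph 1 H) \<and>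
             is_disjoint_union G Hs))) \<and>
     (odd n \<longrightarrow>
        (I = 1 - 2 / real n + 1 / (real n)\<^sup>2 \<longleftrightarrow>
          (\<exists>P Hs. path_graph 2 P \<and> length Hs = (n - 3) div 2 \<and>
             (\<forall>H \<in> set Hs. path_graph 1 H) \<and> is_disjoint_union G (P # Hs)))) \<and>
     1 - 1 / real n - 1 / (real n * real (min_degree G)) \<le> I \<and>
     I \<le> 1 - 1 / real n - 1 / (real n * real (max_degree G)) \<and>
     (I = 1 - 1 / real n - 1 / (real n * real (min_degree G)) \<longleftrightarrow> regular_graph G) \<and>
     (I = 1 - 1 / real n - 1 / (real n * real (max_degree G)) \<longleftrightarrow> regular_graph G)"
proof -
  interpret pair_graph G by fact
  interpret isolated_free_graph G
    using assms(5) by unfold_locales (auto simp: isolated_def)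
  let ?R = "arc_inv_degree_sum G" and ?V = "pverts G"
  have V: "?V \<noteq> {}" using assms(2,3) by auto
  then obtain v0 where "v0 \<in> ?V" by blast
  then obtain u0 where "(u0, v0) \<in> parcs G" by (rule obtain_nbr)
  then have "{u0, v0} \<subseteq> ?V" "u0 \<noteq> v0" using arc_verts no_loops' by blast+
  then have n2: "2 \<le> n" unfolding assms(2) using card_mono[OF pair_finite_verts, of "{u0, v0}"] by simp
  have len: "n = length vs" using distinct_card[OF assms(6)] assms(2,7) by simp
  have I: "I = 1 - 1 / real n - ?R / (real n)\<^sup>2"
    using assms(8) normalized_entries_laplacians[OF assms(7)]
      entropy1_normalized[OF assms(6,7) len _ _ V, of "-1"]
      entropy1_normalized[OF assms(6,7) len _ _ V, of 1] by auto
  \<comment> \<open>\<open>I\<close> is strictly decreasing in \<open>?R\<close>. Every bound of the theorem is the value that \<open>I\<close> would take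
    at \<open>?R = c\<close>, with \<open>c\<close> one of \<open>n/(n-1)\<close>, \<open>n-1\<close>, \<open>n\<close>, \<open>n/\<delta>\<close> and \<open>n/\<Delta>\<close>.\<close>
  have I_le: "I \<le> 1 - 1 / real n - c / (real n)\<^sup>2 \<longleftrightarrow> c \<le> ?R"
    and I_ge: "1 - 1 / real n - c / (real n)\<^sup>2 \<le> I \<longleftrightarrow> ?R \<le> c"
    and I_eq: "I = 1 - 1 / real n - c / (real n)\<^sup>2 \<longleftrightarrow> ?R = c" for c
    using n2 by (auto simp: I divide_right_mono divide_le_cancel)
  have b_complete: "1 - 1 / (real n - 1) = 1 - 1 / real n - (real n / real (n - 1)) / (real n)\<^sup>2"
    using n2 by (simp add: of_nat_diff field_simps power2_eq_square)
  have b_odd: "1 - 2 / real n + 1 / (real n)\<^sup>2 = 1 - 1 / real n - (real n - 1) / (real n)\<^sup>2"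
    using n2 by (simp add: field_simps power2_eq_square)
  have b_even: "1 - 2 / real n = 1 - 1 / real n - (real n / real 1) / (real n)\<^sup>2"
    using n2 by (simp add: field_simps power2_eq_square)
  have b_deg: "1 - 1 / real n - 1 / (real n * real k) = 1 - 1 / real n - (real n / real k) / (real n)\<^sup>2" for k
    using n2 by (simp add: power2_eq_square)

  have deg_le: "vdegree G v \<le> n - 1" if "v \<in> ?V" for v
  proof -
    have "parcs G `` {v} \<subseteq> ?V - {v}" using arc_verts no_loops' by blast
    from card_mono[OF _ this] show ?thesis
      using that pair_finite_verts by (simp add: vdegree_eq_card_nbrs assms(2))
  qed
  have complete: "(\<forall>v\<in>?V. vdegree G v = n - 1) \<longleftrightarrow> complete_digraph n (with_proj G)"
  proof
    assume full: "\<forall>v\<in>?V. vdegree G v = n - 1"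
    have "parcs G `` {v} = ?V - {v}" if "v \<in> ?V" for v
    proof (rule card_subset_eq)
      show "parcs G `` {v} \<subseteq> ?V - {v}" using arc_verts no_loops' by blast
      show "card (parcs G `` {v}) = card (?V - {v})"
        using full that pair_finite_verts by (simp add: vdegree_eq_card_nbrs assms(2))
    qed (use pair_finite_verts in simp)
    then have "parcs G = {(u, v). (u, v) \<in> ?V \<times> ?V \<and> u \<noteq> v}"
      using arc_verts by auto
    then show "complete_digraph n (with_proj G)"
      using pair_finite_verts by (simp add: complete_digraph_pair_def assms(2))
  next
    assume "complete_digraph n (with_proj G)"
    then have "parcs G = {(u, v). (u, v) \<in> ?V \<times> ?V \<and> u \<noteq> v}"
      by (simp add: complete_digraph_pair_def)
    then have "parcs G `` {v} = ?V - {v}" if "v \<in> ?V" for v using that by auto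
    then show "\<forall>v\<in>?V. vdegree G v = n - 1"
      using pair_finite_verts by (simp add: vdegree_eq_card_nbrs assms(2))
  qed
  note upper = arc_inv_degree_sum_lower[of "n - 1", folded assms(2), OF _ deg_le]
  have I1: "I \<le> 1 - 1 / (real n - 1)" and I2: "I = 1 - 1 / (real n - 1) \<longleftrightarrow> complete_digraph n (with_proj G)"
    unfolding b_complete I_le I_eq complete[symmetric] using upper n2 by auto

  have ge1: "1 \<le> vdegree G v" if "v \<in> ?V" for v using vdegree_pos[OF that] by simp
  note lower = arc_inv_degree_sum_upper[of 1, folded assms(2), OF _ ge1]
  have I3: "1 - 2 / real n \<le> I"
    unfolding b_even I_ge using lower by auto
  have I4: "I = 1 - 2 / real n \<longleftrightarrow> (\<exists>Hs. length Hs = n div 2 \<and> (\<forall>H \<in> set Hs. path_graph 1 H) \<and>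
             is_disjoint_union G Hs)" if "even n"
  proof -
    have "2 * l = n \<longleftrightarrow> l = n div 2" for l using that by auto
    then show ?thesis
      unfolding b_even I_eq using lower one_regular_iff_matching[folded assms(2)] by simp
  qed

  \<comment> \<open>A 1-regular graph is a disjoint union of edges, so its order is even.\<close>
  have branching: "\<exists>w\<in>?V. 2 \<le> vdegree G w" if "odd n"
  proof (rule ccontr)
    assume "\<not> ?thesis"
    then have "\<forall>v\<in>?V. vdegree G v = 1" using ge1 by (auto simp: not_le order_antisym less_Suc_eq_le numeral_2_eq_2)
    then obtain Hs :: "'a pair_pre_digraph list" where "2 * length Hs = n"
      using one_regular_iff_matching assms(2) by auto
    with that show False by auto
  qed
  have I5: "1 - 2 / real n + 1 / (real n)\<^sup>2 \<le> I" if "odd n"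
    unfolding b_odd I_ge using branching[OF that] arc_inv_degree_sum_branching(1) assms(2) by auto
  have I6: "I = 1 - 2 / real n + 1 / (real n)\<^sup>2 \<longleftrightarrow>
          (\<exists>P Hs. path_graph 2 P \<and> length Hs = (n - 3) div 2 \<and>
             (\<forall>H \<in> set Hs. path_graph 1 H) \<and> is_disjoint_union G (P # Hs))" if "odd n"
  proof -
    have "3 \<le> n" using n2 that by (cases "n = 2") auto
    then have "2 * l + 3 = n \<longleftrightarrow> l = (n - 3) div 2" for l using that by presburger
    then have "(\<exists>P Hs. path_graph 2 P \<and> length Hs = (n - 3) div 2 \<and>
             (\<forall>H \<in> set Hs. path_graph 1 H) \<and> is_disjoint_union G (P # Hs)) \<longleftrightarrow>
       (\<exists>w\<in>?V. vdegree G w = 2 \<and> (\<forall>v\<in>?V - {w}. vdegree G v = 1))"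
      using one_branching_iff_path_2[folded assms(2)] by simp
    moreover have "?R = real n - 1 \<longleftrightarrow> (\<exists>w\<in>?V. vdegree G w = 2 \<and> (\<forall>v\<in>?V - {w}. vdegree G v = 1))"
      using branching[OF that] arc_inv_degree_sum_branching(2)[folded assms(2)]
        arc_inv_degree_sum_one_branching[folded assms(2)] by (metis DiffI singletonD)
    ultimately show ?thesis unfolding b_odd I_eq by blast
  qed

  have fin: "finite (vdegree G ` ?V)" "vdegree G ` ?V \<noteq> {}" using pair_finite_verts V by auto
  have min: "min_degree G \<in> vdegree G ` ?V" "\<And>v. v \<in> ?V \<Longrightarrow> min_degree G \<le> vdegree G v"
    and max: "max_degree G \<in> vdegree G ` ?V" "\<And>v. v \<in> ?V \<Longrightarrow> vdegree G v \<le> max_degree G"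
    unfolding min_degree_def max_degree_def using fin Min_in Max_in by auto
  have regular: "regular_graph G \<longleftrightarrow> (\<forall>v\<in>?V. vdegree G v = k)" if "k \<in> vdegree G ` ?V" for k
    using that unfolding regular_graph_def by auto
  have pos: "0 < min_degree G" "0 < max_degree G" using min(1) max(1) vdegree_pos by auto
  note mins = arc_inv_degree_sum_upper[of "min_degree G", folded assms(2), OF pos(1) min(2)]
  note maxs = arc_inv_degree_sum_lower[of "max_degree G", folded assms(2), OF pos(2) max(2)]
  have I7: "1 - 1 / real n - 1 / (real n * real (min_degree G)) \<le> I"
    "I \<le> 1 - 1 / real n - 1 / (real n * real (max_degree G))"
    "I = 1 - 1 / real n - 1 / (real n * real (min_degree G)) \<longleftrightarrow> regular_graph G"
    "I = 1 - 1 / real n - 1 / (real n * real (max_degree G)) \<longleftrightarrow> regular_graph G"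
    unfolding b_deg I_le I_ge I_eq regular[OF min(1)] regular[OF max(1)]
    using mins maxs regular[OF min(1)] regular[OF max(1)] by auto
  show ?thesis using I1 I2 I3 I4 I5 I6 I7 by blast
qed

end
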